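(* Let $\gamma:D\to\mathbb C^3$ be a unit speed parametrisation of a holomorphic space curve whose osculating plane is nowhere isotropic, with Frenet-Serret frame $T,N,B$, curvature $\kappa$ and torsion $\tau$. Then the Frenet-Serret formulae hold: $$ \left\{\begin{array}{rcl} T'&=&\kappa N,\\ N'&=&-\kappa T-\tau B,\\ B'&=&\tau N. \end{array}\right. $$
   Context: $D\subset\mathbb C$ is a connected and simply connected open set and $\gamma$ is holomorphic. $\mathbb C^3$ carries the complex bilinear form $\langle v,w\rangle=\sum_{i=1}^3v_iw_i$ and the cross product $z\times w=(z_2w_3-z_3w_2,\,z_3w_1-z_1w_3,\,z_1w_2-z_2w_1)$. Unit speed means $\langle\gamma'(s),\gamma'(s)\rangle=1$ for all $s\in D$. A non-zero vector $v$ is isotropic if $\langle v,v\rangle=0$; a plane is isotropic if its normal vector with respect to $\langle\cdot,\cdot\rangle$ is isotropic. The osculating plane at $s$ is the plane through $\gamma(s)$ parallel to $\gamma'(s)$ and $\gamma''(s)$; it is not isotropic exactly when $\langle\gamma'\times\gamma'',\gamma'\times\gamma''\rangle\neq0$ at $s$. $T=\gamma'$ is the unit tangent vector. Under these assumptions there exist a holomorphic function $\kappa$ on $D$ (the curvature), nowhere zero, and a holomorphic unit vector field $N$ along $\gamma$ (the unit normal, $\langle N,N\rangle=1$) with $T'=\kappa N$. The binormal vector is $B=T\times N$. The vectors $T(s),N(s),B(s)$ form an orthonormal basis of $\mathbb C^3$ with respect to $\langle\cdot,\cdot\rangle$, called the Frenet-Serret frame. The torsion $\tau$ is the holomorphic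 function defined by $B'=\tau N$, i.e. $\tau=\langle B',N\rangle$ ($B'$ being parallel to $N$). *)

theory Defs
  imports "HOL-Complex_Analysis.Complex_Analysis"
begin

(* otherwise $ is ambiguous between power series coefficients and vector components *)
no_notation fps_nth (infixl \<open>$\<close> 75)

text \<open>The complex bilinear form on \<open>\<complex>\<^sup>3\<close>; this is not the Hermitian inner product, so non-zero
  vectors may be orthogonal to themselves.\<close>

definition cbilin :: "complex ^ 3 \<Rightarrow> complex ^ 3 \<Rightarrow> complex"
  where "cbilin v w = (\<Sum>i\<in>UNIV. v $ i * w $ i)"

definition ccross :: "complex ^ 3 \<Rightarrow> complex ^ 3 \<Rightarrow> complex ^ 3"
  where "ccross z w =
    vector [z $ 2 * w $ 3 - z $ 3 * w $ 2, z $ 3 * w $ 1 - z $ 1 * w $ 3, z $ 1 * w $ 2 - z $ 2 * w $ 1]"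

definition isotropic :: "complex ^ 3 \<Rightarrow> bool"
  where "isotropic v \<longleftrightarrow> v \<noteq> 0 \<and> cbilin v v = 0"

definition plane_through :: "complex ^ 3 \<Rightarrow> complex ^ 3 \<Rightarrow> complex ^ 3 \<Rightarrow> (complex ^ 3) set"
  where "plane_through p v w = {p + a *s v + b *s w |a b. True}"

definition is_plane :: "(complex ^ 3) set \<Rightarrow> bool"
  where "is_plane P \<longleftrightarrow>
    (\<exists>p v w. (\<forall>a b. a *s v + b *s w = 0 \<longrightarrow> a = 0 \<and> b = 0) \<and> P = plane_through p v w)"

definition normal_to_plane :: "complex ^ 3 \<Rightarrow> (complex ^ 3) set \<Rightarrow> bool"
  where "normal_to_plane n P \<longleftrightarrow> n \<noteq> 0 \<and> (\<forall>x\<in>P. \<forall>y\<in>P. cbilin n (x - y) = 0)"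

definition isotropic_plane :: "(complex ^ 3) set \<Rightarrow> bool"
  where "isotropic_plane P \<longleftrightarrow> is_plane P \<and> (\<exists>n. normal_to_plane n P \<and> isotropic n)"

text \<open>Holomorphy and the complex derivative of \<open>\<complex>\<^sup>3\<close>-valued functions are taken componentwise.\<close>

definition vholomorphic_on :: "(complex \<Rightarrow> complex ^ 3) \<Rightarrow> complex set \<Rightarrow> bool"
    (infixl \<open>vholomorphic'_on\<close> 50)
  where "f vholomorphic_on D \<longleftrightarrow> (\<forall>i. (\<lambda>z. f z $ i) holomorphic_on D)"

definition vderiv :: "(complex \<Rightarrow> complex ^ 3) \<Rightarrow> complex \<Rightarrow> complex ^ 3"
  where "vderiv f s = (\<chi> i. deriv (\<lambda>z. f z $ i) s)"

definition osculating_plane :: "(complex \<Rightarrow> complex ^ 3) \<Rightarrow> complex \<Rightarrow> (complex ^ 3) set"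
  where "osculating_plane \<gamma> s = plane_through (\<gamma> s) (vderiv \<gamma> s) (vderiv (vderiv \<gamma>) s)"

definition unit_speed_on :: "(complex \<Rightarrow> complex ^ 3) \<Rightarrow> complex set \<Rightarrow> bool"
  where "unit_speed_on \<gamma> D \<longleftrightarrow> (\<forall>s\<in>D. cbilin (vderiv \<gamma> s) (vderiv \<gamma> s) = 1)"

text \<open>The pair \<open>(\<kappa>, N)\<close> is determined by \<open>\<gamma>\<close> only up to a common sign, so the frame is
  a relation rather than a function of \<open>\<gamma>\<close>.  The torsion is the coefficient \<open>\<langle>B', N\<rangle>\<close>; that
  \<open>B'\<close> is parallel to \<open>N\<close> is not part of the definition.\<close>

definition frenet_serret_frame ::
  "complex set \<Rightarrow> (complex \<Rightarrow> complex ^ 3) \<Rightarrow>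
   (complex \<Rightarrow> complex ^ 3) \<Rightarrow> (complex \<Rightarrow> complex ^ 3) \<Rightarrow> (complex \<Rightarrow> complex ^ 3) \<Rightarrow>
   (complex \<Rightarrow> complex) \<Rightarrow> (complex \<Rightarrow> complex) \<Rightarrow> bool"
  where "frenet_serret_frame D \<gamma> T N B \<kappa> \<tau> \<longleftrightarrow>
    (\<forall>s\<in>D. T s = vderiv \<gamma> s) \<and>
    \<kappa> holomorphic_on D \<and> (\<forall>s\<in>D. \<kappa> s \<noteq> 0) \<and>
    N vholomorphic_on D \<and> (\<forall>s\<in>D. cbilin (N s) (N s) = 1) \<and>
    (\<forall>s\<in>D. vderiv T s = \<kappa> s *s N s) \<and>
    (\<forall>s\<in>D. B s = ccross (T s) (N s)) \<and>
    (\<forall>s\<in>D. \<tau> s = cbilin (vderiv B s) (N s))"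

lemmas vec3_simps = cbilin_def ccross_def sum_3 vec_eq_iff forall_3

lemma ccross_eq_0D:
  assumes "ccross v w = 0"
  shows "\<exists>a b. (a \<noteq> 0 \<or> b \<noteq> 0) \<and> a *s v + b *s w = 0"
proof (cases "v = 0")
  case True
  then show ?thesis by (intro exI[of _ 1] exI[of _ 0]) simp
next
  case False
  then obtain i where i: "v $ i \<noteq> 0" by (auto simp: vec_eq_iff)
  have "v $ i * w $ j = w $ i * v $ j" for j
    using assms exhaust_3[of i] exhaust_3[of j] by (auto simp: vec3_simps algebra_simps)
  then have "(- (w $ i)) *s v + (v $ i) *s w = 0" by (simp add: vec_eq_iff)
  with i show ?thesis by blast
qed

lemma ccross_neq_0_iff:
  "ccross v w \<noteq> 0 \<longleftrightarrow> (\<forall>a b. a *s v + b *s w = 0 \<longrightarrow> a = 0 \<and> b = 0)"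
proof
  assume n: "ccross v w \<noteq> 0"
  show "\<forall>a b. a *s v + b *s w = 0 \<longrightarrow> a = 0 \<and> b = 0"
  proof (intro allI impI)
    fix a b assume e: "a *s v + b *s w = 0"
    then have c: "a * v $ i + b * w $ i = 0" for i by (simp add: vec_eq_iff)
    have "a * (v $ i * w $ j - v $ j * w $ i) = w $ j * (a * v $ i + b * w $ i) - w $ i * (a * v $ j + b * w $ j)"
      and "b * (v $ i * w $ j - v $ j * w $ i) = v $ i * (a * v $ j + b * w $ j) - v $ j * (a * v $ i + b * w $ i)"
      for i j by (simp_all add: algebra_simps)
    then have "a * (v $ i * w $ j - v $ j * w $ i) = 0" "b * (v $ i * w $ j - v $ j * w $ i) = 0" for i j
      unfolding c by simp_all
    then have "a *s ccross v w = 0" "b *s ccross v w = 0"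
      unfolding vec_eq_iff forall_3 by (simp_all add: ccross_def)
    then show "a = 0 \<and> b = 0" using n by (simp add: vec.scale_eq_0_iff)
  qed
qed (use ccross_eq_0D in blast)

lemma normal_to_plane_through_iff:
  "normal_to_plane n (plane_through p v w) \<longleftrightarrow> n \<noteq> 0 \<and> cbilin n v = 0 \<and> cbilin n w = 0"
proof -
  have lin: "cbilin n ((p + a *s v + b *s w) - (p + c *s v + d *s w)) =
      (a - c) * cbilin n v + (b - d) * cbilin n w" for a b c d
    by (simp add: cbilin_def sum_3 algebra_simps)
  have "cbilin n v = 0 \<and> cbilin n w = 0"
    if h: "\<forall>x\<in>plane_through p v w. \<forall>y\<in>plane_through p v w. cbilin n (x - y) = 0"
  proof -
    have "(a - c) * cbilin n v + (b - d) * cbilin n w = 0" for a b c d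
      unfolding lin[symmetric] using h by (force simp: plane_through_def)
    from this[of 1 0 0 0] this[of 0 0 1 0] show ?thesis by simp
  qed
  moreover have "\<forall>x\<in>plane_through p v w. \<forall>y\<in>plane_through p v w. cbilin n (x - y) = 0"
    if "cbilin n v = 0" "cbilin n w = 0"
    using that lin by (auto simp: plane_through_def)
  ultimately show ?thesis unfolding normal_to_plane_def by blast
qed

lemma is_plane_through_iff:
  "is_plane (plane_through p v w) \<longleftrightarrow> ccross v w \<noteq> 0"
proof
  assume "is_plane (plane_through p v w)"
  then obtain q x y where xy: "ccross x y \<noteq> 0" and eq: "plane_through p v w = plane_through q x y"
    unfolding is_plane_def ccross_neq_0_iff by blast
  have span: "\<exists>a b. e *s x + f *s y = a *s v + b *s w" for e f
  proof -
    let ?u = "e *s x + f *s y"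
    have "q + 0 *s x + 0 *s y \<in> plane_through q x y" "q + e *s x + f *s y \<in> plane_through q x y"
      unfolding plane_through_def by blast+
    then have "q \<in> plane_through q x y" "q + ?u \<in> plane_through q x y"
      by (simp_all add: add.assoc)
    then have "q \<in> plane_through p v w" "q + ?u \<in> plane_through p v w"
      unfolding eq .
    then obtain a b c d where "q = p + a *s v + b *s w" "q + ?u = p + c *s v + d *s w"
      unfolding plane_through_def by blast
    then have "?u = (p + c *s v + d *s w) - (p + a *s v + b *s w)"
      by (metis add_diff_cancel_left')
    then have "?u = (c - a) *s v + (d - b) *s w"
      by (simp add: vec_eq_iff algebra_simps)
    then show ?thesis by blast
  qed
  obtain a b c d where "x = a *s v + b *s w" "y = c *s v + d *s w"
    using span[of 1 0] span[of 0 1] by auto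
  then have "ccross x y = (a * d - b * c) *s ccross v w"
    by (simp add: vec3_simps algebra_simps)
  with xy show "ccross v w \<noteq> 0" by auto
qed (use ccross_neq_0_iff is_plane_def in blast)

lemma nonisotropic_plane_through_iff:
  "is_plane (plane_through p v w) \<and> \<not> isotropic_plane (plane_through p v w) \<longleftrightarrow>
   cbilin (ccross v w) (ccross v w) \<noteq> 0"
proof -
  let ?n = "ccross v w"
  have "cbilin ?n ?n = 0"
    if m: "cbilin m v = 0" "cbilin m w = 0" "m \<noteq> 0" "cbilin m m = 0" for m
  proof -
    have par: "ccross m ?n = 0"
    proof -
      have "ccross m ?n = cbilin m w *s v - cbilin m v *s w"
        by (simp add: vec3_simps algebra_simps)
      with m show ?thesis by simp
    qed
    have triple: "ccross u (ccross m x) = cbilin u x *s m - cbilin u m *s x" for u x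
      by (simp add: vec3_simps algebra_simps)
    have zero: "ccross u 0 = 0" for u
      by (simp add: vec3_simps)
    have comm: "cbilin ?n m = cbilin m ?n"
      by (simp add: cbilin_def mult.commute)
    have "cbilin m ?n *s m = 0"
      using triple[of m ?n] m(4) by (simp add: par zero)
    then have "cbilin m ?n = 0"
      using m(3) by (simp add: vec.scale_eq_0_iff)
    then have "cbilin ?n ?n *s m = 0"
      using triple[of ?n ?n] by (simp add: par zero comm)
    then show ?thesis
      using m(3) by (simp add: vec.scale_eq_0_iff)
  qed
  moreover have "cbilin ?n v = 0" "cbilin ?n w = 0" "cbilin 0 0 = 0"
    by (simp_all add: vec3_simps algebra_simps)
  ultimately show ?thesis
    unfolding isotropic_plane_def is_plane_through_iff normal_to_plane_through_iff isotropic_def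
    by metis
qed

lemma nonisotropic_osculating_plane_iff:
  "is_plane (osculating_plane \<gamma> s) \<and> \<not> isotropic_plane (osculating_plane \<gamma> s) \<longleftrightarrow>
   cbilin (ccross (vderiv \<gamma> s) (vderiv (vderiv \<gamma>) s))
          (ccross (vderiv \<gamma> s) (vderiv (vderiv \<gamma>) s)) \<noteq> 0"
  unfolding osculating_plane_def by (rule nonisotropic_plane_through_iff)

lemma vholomorphic_on_vderiv:
  assumes "open D" "f vholomorphic_on D"
  shows "vderiv f vholomorphic_on D"
  using assms by (auto simp: vholomorphic_on_def vderiv_def intro: holomorphic_deriv)

lemma frenet_serret_frame_exists:
  assumes D: "open D" "simply_connected D" and "\<gamma> vholomorphic_on D" and us: "unit_speed_on \<gamma> D"
    and ni: "\<forall>s\<in>D. is_plane (osculating_plane \<gamma> s) \<and> \<not> isotropic_plane (osculating_plane \<gamma> s)"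
  shows "\<exists>T N B \<kappa> \<tau>. frenet_serret_frame D \<gamma> T N B \<kappa> \<tau>"
proof -
  define T T' where "T = vderiv \<gamma>" and "T' = vderiv T"
  have hT: "T vholomorphic_on D" and hT': "T' vholomorphic_on D"
    using assms by (simp_all add: T_def T'_def vholomorphic_on_vderiv)
  have TT: "cbilin (T s) (T s) = 1" if "s \<in> D" for s
    using us that by (simp add: unit_speed_on_def T_def)
  have TT': "cbilin (T s) (T' s) = 0" if s: "s \<in> D" for s
  proof -
    have d: "((\<lambda>z. T z $ i) has_field_derivative T' s $ i) (at s)" for i
      using hT s D unfolding T'_def vderiv_def vholomorphic_on_def
      by (auto intro: holomorphic_derivI)
    have "((\<lambda>z. cbilin (T z) (T z)) has_field_derivative 2 * cbilin (T s) (T' s)) (at s)"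
      unfolding cbilin_def sum_3 by (rule derivative_eq_intros d refl)+ (simp add: algebra_simps)
    moreover have "((\<lambda>z. cbilin (T z) (T z)) has_field_derivative 0) (at s)"
      by (rule DERIV_cong_ev[THEN iffD2, OF refl _ refl DERIV_const[of 1]])
         (use D s TT in \<open>auto simp: eventually_nhds\<close>)
    ultimately show ?thesis by (auto dest: DERIV_unique)
  qed
  have nz: "cbilin (T' s) (T' s) \<noteq> 0" if s: "s \<in> D" for s
  proof -
    have "cbilin (ccross (T s) (T' s)) (ccross (T s) (T' s)) =
        cbilin (T s) (T s) * cbilin (T' s) (T' s) - (cbilin (T s) (T' s))\<^sup>2"
      by (simp add: cbilin_def ccross_def sum_3 power2_eq_square algebra_simps)
    moreover have "cbilin (ccross (T s) (T' s)) (ccross (T s) (T' s)) \<noteq> 0"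
      using ni s unfolding nonisotropic_osculating_plane_iff T_def T'_def by blast
    ultimately show ?thesis using TT TT' s by simp
  qed
  have "(\<lambda>s. cbilin (T' s) (T' s)) holomorphic_on D"
    using hT' unfolding cbilin_def vholomorphic_on_def by (intro holomorphic_intros) auto
  then obtain \<kappa> where \<kappa>: "\<kappa> holomorphic_on D" "\<And>s. s \<in> D \<Longrightarrow> cbilin (T' s) (T' s) = (\<kappa> s)\<^sup>2"
    using D(2)[unfolded simply_connected_eq_holomorphic_sqrt[OF D(1)], THEN conjunct2, rule_format,
        of "\<lambda>s. cbilin (T' s) (T' s)"] nz by blast
  have \<kappa>0: "\<kappa> s \<noteq> 0" if "s \<in> D" for s using \<kappa>(2) nz that by fastforce
  define N where "N = (\<lambda>s. inverse (\<kappa> s) *s T' s)"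
  have "N vholomorphic_on D"
    using hT' \<kappa> \<kappa>0 unfolding N_def vholomorphic_on_def by (auto intro!: holomorphic_intros)
  moreover have "cbilin (N s) (N s) = 1" if "s \<in> D" for s
  proof -
    have "cbilin (N s) (N s) = inverse (\<kappa> s) ^ 2 * cbilin (T' s) (T' s)"
      by (simp add: cbilin_def N_def sum_3 power2_eq_square algebra_simps)
    then show ?thesis using \<kappa> \<kappa>0 that by (simp add: field_simps)
  qed
  moreover have "vderiv T s = \<kappa> s *s N s" if "s \<in> D" for s
    using \<kappa>0[OF that] by (simp add: N_def T'_def[symmetric] vec_eq_iff)
  ultimately have "frenet_serret_frame D \<gamma> T N (\<lambda>s. ccross (T s) (N s)) \<kappa>
      (\<lambda>s. cbilin (vderiv (\<lambda>s. ccross (T s) (N s)) s) (N s))"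
    using \<kappa>(1) \<kappa>0 by (simp add: frenet_serret_frame_def T_def)
  then show ?thesis by blast
qed

end

theory Submission
  imports Defs
begin

text \<open>The formula for \<open>T'\<close> is part of what a Frenet-Serret frame is.  For the other two, expand
  \<open>N'\<close> and \<open>B'\<close> in the frame \<open>T, N, B\<close>; they can be recovered from their products with the frame
  vectors because the frame is orthonormal (\<open>orthonormal_expansion\<close>).  The products themselves come
  from differentiating the constant functions \<open>\<langle>T, N\<rangle>\<close>, \<open>\<langle>T, B\<rangle>\<close>, \<open>\<langle>N, B\<rangle>\<close>, \<open>\<langle>N, N\<rangle>\<close> and
  \<open>\<langle>B, B\<rangle>\<close> (\<open>cbilin_vderiv_skew\<close>): the matrix of coefficients of \<open>(T', N', B')\<close> in the frame is
  skew-symmetric.  Its first row is \<open>(0, \<kappa>, 0)\<close> by the formula for \<open>T'\<close> and its entry \<open>\<langle>B', N\<rangle>\<close> is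
  \<open>\<tau>\<close> by definition, so skew-symmetry determines all of it; in particular \<open>B'\<close> is parallel to \<open>N\<close>.

  The orthogonality of \<open>T\<close> and \<open>N\<close> is obtained in the same way: unit speed makes \<open>T'\<close> orthogonal to
  \<open>T\<close>, and \<open>N\<close> is \<open>T'\<close> divided by the nowhere vanishing \<open>\<kappa>\<close>.\<close>

lemma cbilin_commute: "cbilin v w = cbilin w v"
  by (simp add: cbilin_def mult.commute)

lemma cbilin_scale_left: "cbilin (c *s v) w = c * cbilin v w"
  by (simp add: cbilin_def sum_distrib_left mult.assoc)

lemma cbilin_ccross_left: "cbilin v (ccross v w) = 0"
  and cbilin_ccross_right: "cbilin w (ccross v w) = 0"
  by (simp_all add: vec3_simps algebra_simps)

lemma cbilin_ccross_ccross:
  "cbilin (ccross v w) (ccross v w) = cbilin v v * cbilin w w - (cbilin v w)\<^sup>2"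
  by (simp add: vec3_simps power2_eq_square algebra_simps)

lemma ccross_ccross: "ccross u (ccross v w) = cbilin u w *s v - cbilin u v *s w"
  by (simp add: vec3_simps algebra_simps)

text \<open>A complex bilinear form has isotropic vectors, so a remainder orthogonal to \<open>t\<close>, \<open>n\<close> and
  \<open>t \<times> n\<close> does not vanish by positivity.  Instead, with \<open>b = t \<times> n\<close>, the triple product identity
  evaluates \<open>b \<times> (w \<times> b)\<close> in two ways: directly as \<open>w - \<langle>w, b\<rangle> b\<close>, and, after expanding \<open>w \<times> b\<close>
  in \<open>t\<close> and \<open>n\<close>, as \<open>\<langle>w, t\<rangle> t + \<langle>w, n\<rangle> n\<close>, because \<open>b \<times> t = n\<close> and \<open>b \<times> n = - t\<close>.\<close>

lemma orthonormal_expansion: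
  assumes "cbilin t t = 1" "cbilin n n = 1" "cbilin t n = 0"
  shows "w = cbilin w t *s t + cbilin w n *s n + cbilin w (ccross t n) *s ccross t n"
proof -
  define b where "b = ccross t n"
  have bb: "cbilin b b = 1"
    using assms by (simp add: b_def cbilin_ccross_ccross)
  have "ccross b t = - ccross t b" "ccross b n = - ccross n b"
    by (simp_all add: vec3_simps)
  then have "ccross b t = n" "ccross b n = - t"
    using assms by (simp_all add: b_def ccross_ccross cbilin_commute[of n t])
  moreover have "ccross w b = cbilin w n *s t - cbilin w t *s n"
    by (simp add: b_def ccross_ccross)
  moreover have "ccross b (x *s u - y *s v) = x *s ccross b u - y *s ccross b v" for x y u v
    by (simp add: vec3_simps algebra_simps)
  ultimately have "ccross b (ccross w b) = cbilin w n *s n + cbilin w t *s t"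
    by (simp add: vector_smult_rneg)
  moreover have "ccross b (ccross w b) = w - cbilin w b *s b"
    using bb by (simp add: ccross_ccross cbilin_commute[of b w])
  ultimately show ?thesis
    by (simp add: b_def[symmetric] algebra_simps)
qed

lemma vholomorphic_on_cong:
  "(\<And>s. s \<in> D \<Longrightarrow> f s = g s) \<Longrightarrow> f vholomorphic_on D \<longleftrightarrow> g vholomorphic_on D"
  by (simp add: vholomorphic_on_def cong: holomorphic_cong)

lemma vholomorphic_on_ccross:
  assumes "f vholomorphic_on D" "g vholomorphic_on D"
  shows "(\<lambda>s. ccross (f s) (g s)) vholomorphic_on D"
  using assms unfolding vholomorphic_on_def forall_3
  by (auto simp: ccross_def intro!: holomorphic_intros)

lemma has_field_derivative_component:
  assumes "open D" "f vholomorphic_on D" "s \<in> D"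
  shows "((\<lambda>z. f z $ i) has_field_derivative vderiv f s $ i) (at s)"
  using assms unfolding vderiv_def vholomorphic_on_def by (auto intro: holomorphic_derivI)

lemma has_field_derivative_cbilin:
  assumes "open D" "f vholomorphic_on D" "g vholomorphic_on D" "s \<in> D"
  shows "((\<lambda>z. cbilin (f z) (g z)) has_field_derivative
           cbilin (vderiv f s) (g s) + cbilin (f s) (vderiv g s)) (at s)"
  unfolding cbilin_def sum_3
  by (rule derivative_eq_intros refl has_field_derivative_component[OF assms(1,2,4)]
        has_field_derivative_component[OF assms(1,3,4)])+ (simp add: algebra_simps)

text \<open>Applied to two vectors of an orthonormal frame, the product rule gives the skew-symmetry of
  the matrix that expresses the derivatives of the frame in the frame itself.\<close>

lemma cbilin_vderiv_skew:
  assumes "open D" "f vholomorphic_on D" "g vholomorphic_on D" "s \<in> D"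
    and const: "\<And>z. z \<in> D \<Longrightarrow> cbilin (f z) (g z) = c"
  shows "cbilin (vderiv f s) (g s) = - cbilin (vderiv g s) (f s)"
proof -
  have "((\<lambda>z. cbilin (f z) (g z)) has_field_derivative 0) (at s)"
    by (rule has_field_derivative_transform_within_open[OF DERIV_const[of c] assms(1,4)])
       (simp add: const)
  from DERIV_unique[OF has_field_derivative_cbilin[OF assms(1-4)] this] show ?thesis
    by (simp add: cbilin_commute[of "f s" "vderiv g s"] eq_neg_iff_add_eq_0)
qed

corollary cbilin_vderiv_self:
  assumes "open D" "f vholomorphic_on D" "s \<in> D" "\<And>z. z \<in> D \<Longrightarrow> cbilin (f z) (f z) = c"
  shows "cbilin (vderiv f s) (f s) = 0"
  using cbilin_vderiv_skew[OF assms(1,2,2,3,4)] by simp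

theorem proposition4p2:
  fixes D :: "complex set"
    and \<gamma> T N B :: "complex \<Rightarrow> complex ^ 3"
    and \<kappa> \<tau> :: "complex \<Rightarrow> complex"
  assumes "open D" and "connected D" and "simply_connected D"
    and "\<gamma> vholomorphic_on D"
    and "unit_speed_on \<gamma> D"
    and "\<forall>s\<in>D. is_plane (osculating_plane \<gamma> s) \<and> \<not> isotropic_plane (osculating_plane \<gamma> s)"
    and "frenet_serret_frame D \<gamma> T N B \<kappa> \<tau>"
  shows "\<forall>s\<in>D. vderiv T s = \<kappa> s *s N s \<and>
               vderiv N s = - (\<kappa> s *s T s) - \<tau> s *s B s \<and>
               vderiv B s = \<tau> s *s N s"
proof (intro ballI conjI)
  fix s assume s: "s \<in> D"
  note D = \<open>open D\<close>
  note frame = assms(7)[unfolded frenet_serret_frame_def]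
  have T': "vderiv T z = \<kappa> z *s N z" and B: "B z = ccross (T z) (N z)"
    and NN: "cbilin (N z) (N z) = 1" and \<kappa>: "\<kappa> z \<noteq> 0" if "z \<in> D" for z
    using frame that by auto
  have \<tau>: "\<tau> s = cbilin (vderiv B s) (N s)"
    using frame s by auto
  have hN: "N vholomorphic_on D"
    using frame by auto
  have hT: "T vholomorphic_on D"
    using vholomorphic_on_vderiv[OF D assms(4)] vholomorphic_on_cong[of D T "vderiv \<gamma>"] frame
    by auto
  have hB: "B vholomorphic_on D"
    using vholomorphic_on_ccross[OF hT hN] B
      vholomorphic_on_cong[of D B "\<lambda>s. ccross (T s) (N s)"] by simp

  have TT: "cbilin (T z) (T z) = 1" if "z \<in> D" for z
    using assms(5) frame that by (auto simp: unit_speed_on_def)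
  have TN: "cbilin (T z) (N z) = 0" if "z \<in> D" for z
    using cbilin_vderiv_self[OF D hT that TT] that
    by (simp add: T' \<kappa> cbilin_scale_left cbilin_commute[of "T z" "N z"])
  have TB: "cbilin (T z) (B z) = 0" and NB: "cbilin (N z) (B z) = 0" if "z \<in> D" for z
    using that by (simp_all add: B cbilin_ccross_left cbilin_ccross_right)
  have BB: "cbilin (B z) (B z) = 1" if "z \<in> D" for z
    using that by (simp add: B cbilin_ccross_ccross TT NN TN)

  have N'T: "cbilin (vderiv N s) (T s) = - \<kappa> s"
    using cbilin_vderiv_skew[OF D hT hN s TN] s by (simp add: T' cbilin_scale_left NN)
  have N'N: "cbilin (vderiv N s) (N s) = 0"
    using cbilin_vderiv_self[OF D hN s NN] .
  have N'B: "cbilin (vderiv N s) (B s) = - \<tau> s"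
    using cbilin_vderiv_skew[OF D hN hB s NB] by (simp add: \<tau>)
  have B'T: "cbilin (vderiv B s) (T s) = 0"
    using cbilin_vderiv_skew[OF D hT hB s TB] s by (simp add: T' cbilin_scale_left NB)
  have B'B: "cbilin (vderiv B s) (B s) = 0"
    using cbilin_vderiv_self[OF D hB s BB] .

  have expand: "w = cbilin w (T s) *s T s + cbilin w (N s) *s N s + cbilin w (B s) *s B s" for w
    using orthonormal_expansion[OF TT NN TN] s by (simp add: B)
  show "vderiv T s = \<kappa> s *s N s"
    using s by (rule T')
  show "vderiv N s = - (\<kappa> s *s T s) - \<tau> s *s B s"
    using expand[of "vderiv N s"] by (simp add: N'T N'N N'B)
  show "vderiv B s = \<tau> s *s N s"
    using expand[of "vderiv B s"] by (simp add: B'T B'B \<tau>)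
qed

end
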